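(* Let $R_1$ and $R_2$ be two finite commutative rings and let $R=R_1\times R_2$. Then, for every integer $k\ge 2$, $$\zeta_k(R)=\zeta_k(R_1)\,\zeta_k(R_2).$$
   Context: For a finite commutative ring $R$, let $\mathcal I(R)$ denote the set of all ideals of $R$, and let $(0)$ denote the zero ideal. For an integer $k\ge 2$, the ideal zero-product probability is $$\zeta_k(R)=\frac{|\{(I_1,\ldots,I_k)\in\mathcal I(R)^k : I_1I_2\cdots I_k=(0)\}|}{|\mathcal I(R)|^k},$$ where $I_1\cdots I_k$ is the usual product of ideals. *)

theory Defs
  imports Complex_Main "HOL-Library.FuncSet" "HOL-Algebra.Chinese_Remainder"
begin

text \<open>
  The ideal zero-product probability of a finite commutative ring with identity.
  \<^const>\<open>ideals_set\<close> is the monoid of all ideals under the usual product of ideals, with the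
  whole ring as unit, so \<^const>\<open>finprod\<close> in it is the product of a finite family of ideals.
  A \<open>k\<close>-tuple of ideals is an extensional function on \<open>{..<k}\<close>.
\<close>

definition ideal_zero_prod_prob :: "nat \<Rightarrow> ('a, 'm) ring_scheme \<Rightarrow> real"
  where "ideal_zero_prod_prob k R =
    real (card {Is \<in> {..<k} \<rightarrow>\<^sub>E {I. ideal I R}.
                  finprod (ideals_set R) Is {..<k} = {\<zero>\<^bsub>R\<^esub>}})
    / real (card {I. ideal I R}) ^ k"

end

theory Submission
  imports Defs
begin

text \<open>
  Since the rings are unital, multiplying by \<open>(1, 0)\<close> and \<open>(0, 1)\<close> shows that every ideal of
  \<open>R\<^sub>1 \<times> R\<^sub>2\<close> is \<open>A \<times> B\<close> for unique ideals \<open>A\<close> of \<open>R\<^sub>1\<close> and \<open>B\<close> of \<open>R\<^sub>2\<close>. Products of ideals are formed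
  componentwise, so both the numerator and the denominator of \<open>\<zeta>\<^sub>k\<close> are multiplicative.
\<close>

section \<open>Arithmetic of the direct product, and a criterion for ideals\<close>

lemma RDirProd_mult [simp]:
  "(a, b) \<otimes>\<^bsub>RDirProd R S\<^esub> (c, d) = (a \<otimes>\<^bsub>R\<^esub> c, b \<otimes>\<^bsub>S\<^esub> d)"
  by (simp add: RDirProd_def DirProd_def monoid.defs)

lemma RDirProd_add [simp]:
  "(a, b) \<oplus>\<^bsub>RDirProd R S\<^esub> (c, d) = (a \<oplus>\<^bsub>R\<^esub> c, b \<oplus>\<^bsub>S\<^esub> d)"
  by (simp add: RDirProd_def DirProd_def monoid.defs)

lemma RDirProd_zero [simp]: "\<zero>\<^bsub>RDirProd R S\<^esub> = (\<zero>\<^bsub>R\<^esub>, \<zero>\<^bsub>S\<^esub>)"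
  by (simp add: RDirProd_def monoid.defs)

text \<open>Commutativity of the product is what makes its ideals a commutative monoid, so that
  \<open>finprod\<close> can be used there.\<close>

lemma RDirProd_cring:
  assumes "cring R" "cring S"
  shows "cring (RDirProd R S)"
proof -
  interpret R: cring R by fact
  interpret S: cring S by fact
  interpret P: ring "RDirProd R S"
    by (intro RDirProd_ring R.ring_axioms S.ring_axioms)
  show ?thesis
    by unfold_locales (auto simp: RDirProd_carrier R.m_comm S.m_comm)
qed

text \<open>Absorption already yields negatives, since \<open>\<ominus> a\<close> is the product of
  \<open>\<ominus> \<one>\<close> and \<open>a\<close>; only sums and multiples remain to be
  checked.\<close>

lemma (in ring) idealI_no_neg:
  assumes carr: "I \<subseteq> carrier R" and zero: "\<zero> \<in> I"
    and add: "\<And>a b. \<lbrakk>a \<in> I; b \<in> I\<rbrakk> \<Longrightarrow> a \<oplus> b \<in> I"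
    and left: "\<And>a x. \<lbrakk>a \<in> I; x \<in> carrier R\<rbrakk> \<Longrightarrow> x \<otimes> a \<in> I"
    and right: "\<And>a x. \<lbrakk>a \<in> I; x \<in> carrier R\<rbrakk> \<Longrightarrow> a \<otimes> x \<in> I"
  shows "ideal I R"
proof (rule idealI[OF ring_axioms])
  show "subgroup I (add_monoid R)"
  proof (rule add.subgroupI)
    fix a assume a: "a \<in> I"
    have "(\<ominus> \<one>) \<otimes> a = \<ominus> a"
      using a carr by (auto simp: l_minus)
    with left[OF a, of "\<ominus> \<one>"] show "\<ominus> a \<in> I" by simp
  qed (use assms in auto)
qed (use left right in auto)

section \<open>Ideals of a direct product and their pairwise products\<close>

lemma ideal_zero_mem: "ideal I R \<Longrightarrow> \<zero>\<^bsub>R\<^esub> \<in> I"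
  by (simp add: additive_subgroup.zero_closed ideal.axioms(1))

lemma ideal_add_mem: "\<lbrakk>ideal I R; a \<in> I; b \<in> I\<rbrakk> \<Longrightarrow> a \<oplus>\<^bsub>R\<^esub> b \<in> I"
  by (simp add: additive_subgroup.a_closed ideal.axioms(1))

lemma ideal_times:
  assumes "ideal A R" "ideal B S"
  shows "ideal (A \<times> B) (RDirProd R S)"
proof -
  interpret R: ring R by (rule ideal.axioms(2)) fact
  interpret S: ring S by (rule ideal.axioms(2)) fact
  interpret P: ring "RDirProd R S"
    by (intro RDirProd_ring R.ring_axioms S.ring_axioms)
  show ?thesis
    by (rule P.idealI_no_neg)
      (use assms in \<open>auto simp: RDirProd_carrier ideal_zero_mem ideal_add_mem
         ideal.I_l_closed ideal.I_r_closed ideal.Icarr\<close>)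
qed

text \<open>The witnesses \<open>A\<close> and \<open>B\<close> are the slices of \<open>I\<close>
  along the two axes. The idempotents (1, 0) and (0, 1) carry each element of \<open>I\<close> into
  these slices, and the sum of the two images is the element itself.\<close>

lemma ideal_RDirProd_cases:
  assumes "ring R" "ring S" and I: "ideal I (RDirProd R S)"
  obtains A B where "ideal A R" "ideal B S" "I = A \<times> B"
proof -
  interpret R: ring R by fact
  interpret S: ring S by fact
  define A where "A = {a. (a, \<zero>\<^bsub>S\<^esub>) \<in> I}"
  define B where "B = {b. (\<zero>\<^bsub>R\<^esub>, b) \<in> I}"
  have carr: "a \<in> carrier R" "b \<in> carrier S" if "(a, b) \<in> I" for a b
    using ideal.Icarr[OF I that] by (auto simp: RDirProd_carrier)
  have zero: "(\<zero>\<^bsub>R\<^esub>, \<zero>\<^bsub>S\<^esub>) \<in> I"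
    using ideal_zero_mem[OF I] by simp
  have add: "(a \<oplus>\<^bsub>R\<^esub> c, b \<oplus>\<^bsub>S\<^esub> d) \<in> I" if "(a, b) \<in> I" "(c, d) \<in> I" for a b c d
    using ideal_add_mem[OF I that] by simp
  have left: "(x \<otimes>\<^bsub>R\<^esub> a, y \<otimes>\<^bsub>S\<^esub> b) \<in> I"
    if "(a, b) \<in> I" "x \<in> carrier R" "y \<in> carrier S" for a b x y
    using ideal.I_l_closed[OF I that(1), of "(x, y)"] that by (simp add: RDirProd_carrier)
  have right: "(a \<otimes>\<^bsub>R\<^esub> x, b \<otimes>\<^bsub>S\<^esub> y) \<in> I"
    if "(a, b) \<in> I" "x \<in> carrier R" "y \<in> carrier S" for a b x y
    using ideal.I_r_closed[OF I that(1), of "(x, y)"] that by (simp add: RDirProd_carrier)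
  have "ideal A R"
  proof (rule R.idealI_no_neg)
    show "a \<oplus>\<^bsub>R\<^esub> b \<in> A" if "a \<in> A" "b \<in> A" for a b
      using that add[of a "\<zero>\<^bsub>S\<^esub>" b "\<zero>\<^bsub>S\<^esub>"] by (simp add: A_def)
    show "x \<otimes>\<^bsub>R\<^esub> a \<in> A" if "a \<in> A" "x \<in> carrier R" for a x
      using that left[of a "\<zero>\<^bsub>S\<^esub>" x "\<zero>\<^bsub>S\<^esub>"] by (simp add: A_def)
    show "a \<otimes>\<^bsub>R\<^esub> x \<in> A" if "a \<in> A" "x \<in> carrier R" for a x
      using that right[of a "\<zero>\<^bsub>S\<^esub>" x "\<zero>\<^bsub>S\<^esub>"] by (simp add: A_def)
  qed (use carr zero in \<open>auto simp: A_def\<close>)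
  moreover have "ideal B S"
  proof (rule S.idealI_no_neg)
    show "a \<oplus>\<^bsub>S\<^esub> b \<in> B" if "a \<in> B" "b \<in> B" for a b
      using that add[of "\<zero>\<^bsub>R\<^esub>" a "\<zero>\<^bsub>R\<^esub>" b] by (simp add: B_def)
    show "x \<otimes>\<^bsub>S\<^esub> a \<in> B" if "a \<in> B" "x \<in> carrier S" for a x
      using that left[of "\<zero>\<^bsub>R\<^esub>" a "\<zero>\<^bsub>R\<^esub>" x] by (simp add: B_def)
    show "a \<otimes>\<^bsub>S\<^esub> x \<in> B" if "a \<in> B" "x \<in> carrier S" for a x
      using that right[of "\<zero>\<^bsub>R\<^esub>" a "\<zero>\<^bsub>R\<^esub>" x] by (simp add: B_def)
  qed (use carr zero in \<open>auto simp: B_def\<close>)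
  moreover have "I = A \<times> B"
  proof -
    have split: "(a, b) \<in> I \<longleftrightarrow> (a, \<zero>\<^bsub>S\<^esub>) \<in> I \<and> (\<zero>\<^bsub>R\<^esub>, b) \<in> I" for a b
    proof
      assume ab: "(a, b) \<in> I"
      show "(a, \<zero>\<^bsub>S\<^esub>) \<in> I \<and> (\<zero>\<^bsub>R\<^esub>, b) \<in> I"
        using left[OF ab, of "\<one>\<^bsub>R\<^esub>" "\<zero>\<^bsub>S\<^esub>"] left[OF ab, of "\<zero>\<^bsub>R\<^esub>" "\<one>\<^bsub>S\<^esub>"] carr[OF ab] by simp
    next
      assume "(a, \<zero>\<^bsub>S\<^esub>) \<in> I \<and> (\<zero>\<^bsub>R\<^esub>, b) \<in> I"
      then show "(a, b) \<in> I"
        using add[of a "\<zero>\<^bsub>S\<^esub>" "\<zero>\<^bsub>R\<^esub>" b] carr by auto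
    qed
    have "p \<in> I \<longleftrightarrow> p \<in> A \<times> B" for p
      unfolding A_def B_def mem_Times_iff mem_Collect_eq
      using split[of "fst p" "snd p"] by (simp only: prod.collapse)
    then show ?thesis by blast
  qed
  ultimately show thesis by (rule that)
qed

text \<open>A Cartesian product determines its factors as soon as none of them is empty, and every
  ideal contains zero.\<close>

lemma ideal_times_inject:
  assumes "ideal A R" "ideal B S" "ideal A' R" "ideal B' S"
  shows "A \<times> B = A' \<times> B' \<longleftrightarrow> A = A' \<and> B = B'"
  using assms[THEN ideal_zero_mem] by (auto simp: times_eq_iff)

text \<open>This counts the ideals of the product ring and so gives the denominator of the
  probability.\<close>

lemma bij_betw_ideals_times:
  assumes "ring R" "ring S"
  shows "bij_betw (\<lambda>(A, B). A \<times> B) ({I. ideal I R} \<times> {I. ideal I S})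
           {I. ideal I (RDirProd R S)}"
  unfolding bij_betw_def
proof
  show "inj_on (\<lambda>(A, B). A \<times> B) ({I. ideal I R} \<times> {I. ideal I S})"
    by (auto simp: inj_on_def ideal_times_inject)
  show "(\<lambda>(A, B). A \<times> B) ` ({I. ideal I R} \<times> {I. ideal I S}) = {I. ideal I (RDirProd R S)}"
    by (auto intro: ideal_times elim!: ideal_RDirProd_cases[OF assms])
qed

text \<open>Componentwise multiplication and addition give one inclusion. For the other, each factor
  is embedded along its axis, and (m, n) is the sum of (m, 0) and (0, n).\<close>

lemma ideal_prod_times:
  assumes A: "ideal A R" "ideal A' R" and B: "ideal B S" "ideal B' S"
  shows "ideal_prod (RDirProd R S) (A \<times> B) (A' \<times> B') = ideal_prod R A A' \<times> ideal_prod S B B'"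
    (is "?L = ?M \<times> ?N")
proof
  interpret R: ring R using A(1) by (rule ideal.axioms(2))
  interpret S: ring S using B(1) by (rule ideal.axioms(2))
  interpret P: ring "RDirProd R S"
    by (intro RDirProd_ring R.ring_axioms S.ring_axioms)
  have M: "ideal ?M R" by (rule R.ideal_prod_is_ideal[OF A])
  have N: "ideal ?N S" by (rule S.ideal_prod_is_ideal[OF B])
  have L: "ideal ?L (RDirProd R S)"
    by (intro P.ideal_prod_is_ideal ideal_times A B)
  show "?L \<subseteq> ?M \<times> ?N"
  proof
    show "p \<in> ?M \<times> ?N" if "p \<in> ?L" for p
      using that by induct (auto intro: ideal_prod.intros)
  qed
  \<comment> \<open>Padding with zero respects the generation of \<open>?M\<close>: zero lies in
    both \<open>B\<close> and \<open>B'\<close>, and it is preserved by products and sums of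
    zeros.\<close>
  have left: "(m, \<zero>\<^bsub>S\<^esub>) \<in> ?L" if "m \<in> ?M" for m
    using that
  proof induct
    case (prod i j)
    have "(i, \<zero>\<^bsub>S\<^esub>) \<otimes>\<^bsub>RDirProd R S\<^esub> (j, \<zero>\<^bsub>S\<^esub>) \<in> ?L"
      by (rule ideal_prod.prod) (use prod B[THEN ideal_zero_mem] in auto)
    then show ?case by simp
  next
    case (sum s t)
    then show ?case using ideal_prod.sum[OF sum(2,4)] by simp
  qed
  have right: "(\<zero>\<^bsub>R\<^esub>, n) \<in> ?L" if "n \<in> ?N" for n
    using that
  proof induct
    case (prod i j)
    have "(\<zero>\<^bsub>R\<^esub>, i) \<otimes>\<^bsub>RDirProd R S\<^esub> (\<zero>\<^bsub>R\<^esub>, j) \<in> ?L"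
      by (rule ideal_prod.prod) (use prod A[THEN ideal_zero_mem] in auto)
    then show ?case by simp
  next
    case (sum s t)
    then show ?case using ideal_prod.sum[OF sum(2,4)] by simp
  qed
  show "?M \<times> ?N \<subseteq> ?L"
  proof clarify
    fix m n assume m: "m \<in> ?M" and n: "n \<in> ?N"
    show "(m, n) \<in> ?L"
      using ideal_add_mem[OF L left[OF m] right[OF n]] ideal.Icarr[OF M m] ideal.Icarr[OF N n]
      by simp
  qed
qed

section \<open>Finite products of ideals and the count of zero products\<close>

lemma carrier_ideals_set [simp]: "carrier (ideals_set R) = {I. ideal I R}"
  and mult_ideals_set [simp]: "mult (ideals_set R) = ideal_prod R"
  and one_ideals_set [simp]: "\<one>\<^bsub>ideals_set R\<^esub> = carrier R"
  by (simp_all add: ideals_set_def)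

text \<open>Induction on \<open>X\<close>: the empty product is the whole ring, whose carrier is the
  product of the two carriers, and each further factor is handled by
  \<open>ideal_prod_times\<close>.\<close>

lemma finprod_ideals_times:
  assumes "cring R" "cring S" and "finite X"
    and "f \<in> X \<rightarrow> {I. ideal I R}" "g \<in> X \<rightarrow> {I. ideal I S}"
  shows "finprod (ideals_set (RDirProd R S)) (\<lambda>i. f i \<times> g i) X
         = finprod (ideals_set R) f X \<times> finprod (ideals_set S) g X"
proof -
  interpret R: comm_monoid "ideals_set R"
    using cring.ideals_set_is_comm_monoid[OF assms(1)] .
  interpret S: comm_monoid "ideals_set S"
    using cring.ideals_set_is_comm_monoid[OF assms(2)] .
  interpret P: comm_monoid "ideals_set (RDirProd R S)"
    using cring.ideals_set_is_comm_monoid[OF RDirProd_cring[OF assms(1,2)]] .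
  show ?thesis
    using assms(3-5)
  proof (induction X)
    case empty
    then show ?case by (simp add: RDirProd_carrier)
  next
    case (insert x X)
    \<comment> \<open>\<open>ideal_prod_times\<close> needs the partial products to be ideals
      again.\<close>
    have "ideal (finprod (ideals_set R) f X) R" "ideal (finprod (ideals_set S) g X) S"
      using R.finprod_closed[of f X] S.finprod_closed[of g X] insert.prems by simp_all
    moreover have "(\<lambda>i. f i \<times> g i) \<in> X \<rightarrow> carrier (ideals_set (RDirProd R S))"
      using insert.prems by (auto intro!: ideal_times)
    ultimately show ?case
      using insert by (simp add: Pi_iff ideal_prod_times ideal_times)
  qed
qed

text \<open>Taking products pointwise matches pairs of families with families in the product ring,
  and the product of a combined family is zero exactly when both component products are.\<close>

lemma card_zero_prod_families_times:
  fixes R :: "('a, 'm) ring_scheme" and S :: "('b, 'n) ring_scheme"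
  assumes R: "cring R" and S: "cring S" and X: "finite X"
  shows "card {Is \<in> X \<rightarrow>\<^sub>E {I. ideal I (RDirProd R S)}.
             finprod (ideals_set (RDirProd R S)) Is X = {\<zero>\<^bsub>RDirProd R S\<^esub>}}
       = card {Is \<in> X \<rightarrow>\<^sub>E {I. ideal I R}. finprod (ideals_set R) Is X = {\<zero>\<^bsub>R\<^esub>}}
       * card {Is \<in> X \<rightarrow>\<^sub>E {I. ideal I S}. finprod (ideals_set S) Is X = {\<zero>\<^bsub>S\<^esub>}}"
    (is "card ?P = card ?F * card ?G")
proof -
  interpret cR: cring R by fact
  interpret cS: cring S by fact
  interpret mR: comm_monoid "ideals_set R" by (rule cR.ideals_set_is_comm_monoid)
  interpret mS: comm_monoid "ideals_set S" by (rule cS.ideals_set_is_comm_monoid)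
  interpret mP: comm_monoid "ideals_set (RDirProd R S)"
    by (rule cring.ideals_set_is_comm_monoid[OF RDirProd_cring[OF R S]])
  \<comment> \<open>The restriction to \<open>X\<close> makes the combined family extensional, as
    membership in \<open>\<rightarrow>\<^sub>E\<close> demands.\<close>
  define h where "h = (\<lambda>(f :: _ \<Rightarrow> 'a set, g :: _ \<Rightarrow> 'b set). \<lambda>i\<in>X. f i \<times> g i)"
  have prod_h: "finprod (ideals_set (RDirProd R S)) (h (f, g)) X = {\<zero>\<^bsub>RDirProd R S\<^esub>}
      \<longleftrightarrow> finprod (ideals_set R) f X = {\<zero>\<^bsub>R\<^esub>} \<and> finprod (ideals_set S) g X = {\<zero>\<^bsub>S\<^esub>}"
    if f: "f \<in> X \<rightarrow>\<^sub>E {I. ideal I R}" and g: "g \<in> X \<rightarrow>\<^sub>E {I. ideal I S}" for f g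
  proof -
    have f': "f \<in> X \<rightarrow> {I. ideal I R}" and g': "g \<in> X \<rightarrow> {I. ideal I S}"
      using f g by auto
    have "finprod (ideals_set (RDirProd R S)) (h (f, g)) X
        = finprod (ideals_set (RDirProd R S)) (\<lambda>i. f i \<times> g i) X"
      using f' g' by (intro mP.finprod_cong') (auto simp: h_def intro!: ideal_times)
    also have "\<dots> = finprod (ideals_set R) f X \<times> finprod (ideals_set S) g X"
      by (rule finprod_ideals_times[OF R S X f' g'])
    finally have eq: "finprod (ideals_set (RDirProd R S)) (h (f, g)) X = \<dots>" .
    have "ideal (finprod (ideals_set R) f X) R" "ideal (finprod (ideals_set S) g X) S"
      using mR.finprod_closed[of f X] mS.finprod_closed[of g X] f' g' by simp_all
    then show ?thesis
      \<comment> \<open>The zero ideal of the product ring is the product of the two zero ideals, so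
        uniqueness of the factors splits the condition.\<close>
      using ideal_times_inject[OF _ _ cR.zeroideal cS.zeroideal] by (simp add: eq)
  qed
  have "bij_betw h (?F \<times> ?G) ?P"
    unfolding bij_betw_def
  proof
    show "inj_on h (?F \<times> ?G)"
    proof (rule inj_onI, clarify)
      fix f g f' g'
      assume f: "f \<in> X \<rightarrow>\<^sub>E {I. ideal I R}" "f' \<in> X \<rightarrow>\<^sub>E {I. ideal I R}"
        and g: "g \<in> X \<rightarrow>\<^sub>E {I. ideal I S}" "g' \<in> X \<rightarrow>\<^sub>E {I. ideal I S}"
        and eq: "h (f, g) = h (f', g')"
      have "f i = f' i \<and> g i = g' i" if i: "i \<in> X" for i
      proof -
        have "f i \<times> g i = f' i \<times> g' i"
          using fun_cong[OF eq, of i] i by (simp add: h_def)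
        moreover have "ideal (f i) R" "ideal (f' i) R" "ideal (g i) S" "ideal (g' i) S"
          using f g i by auto
        ultimately show ?thesis
          using ideal_times_inject[of "f i" R "g i" S "f' i" "g' i"] by simp
      qed
      then show "f = f' \<and> g = g'"
        using PiE_ext[OF f] PiE_ext[OF g] by blast
    qed
    show "h ` (?F \<times> ?G) = ?P"
    proof (intro equalityI subsetI)
      fix p assume "p \<in> h ` (?F \<times> ?G)"
      then obtain f g where fg: "f \<in> ?F" "g \<in> ?G" and p: "p = h (f, g)"
        by auto
      have "h (f, g) \<in> X \<rightarrow>\<^sub>E {I. ideal I (RDirProd R S)}"
        using fg by (auto simp: h_def intro!: ideal_times)
      then show "p \<in> ?P"
        using fg prod_h p by simp
    next
      fix p assume p: "p \<in> ?P"
      have "\<exists>A B. ideal A R \<and> ideal B S \<and> p i = A \<times> B" if "i \<in> X" for i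
      proof -
        have "ideal (p i) (RDirProd R S)" using p that by auto
        then show ?thesis
          by (metis ideal_RDirProd_cases cR.ring_axioms cS.ring_axioms)
      qed
      \<comment> \<open>Choosing a decomposition at every index gives two families whose values
        outside \<open>X\<close> are arbitrary; restricting them below makes them
        extensional.\<close>
      then obtain f g where fg: "\<And>i. i \<in> X \<Longrightarrow> ideal (f i) R \<and> ideal (g i) S \<and> p i = f i \<times> g i"
        by metis
      let ?f = "restrict f X" and ?g = "restrict g X"
      have mem: "?f \<in> X \<rightarrow>\<^sub>E {I. ideal I R}" "?g \<in> X \<rightarrow>\<^sub>E {I. ideal I S}"
        using fg by auto
      have "p \<in> extensional X" using p by (simp add: PiE_def)
      \<comment> \<open>Outside \<open>X\<close> both sides are \<open>undefined\<close>; inside,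
        this is the chosen decomposition.\<close>
      then have p_eq: "p = h (?f, ?g)"
        using fg by (auto simp: h_def extensional_def fun_eq_iff)
      then have "(?f, ?g) \<in> ?F \<times> ?G"
        using p mem prod_h[OF mem] by simp
      then show "p \<in> h ` (?F \<times> ?G)"
        using p_eq by blast
    qed
  qed
  from bij_betw_same_card[OF this] show ?thesis
    by (simp only: card_cartesian_product)
qed

theorem theorem3p1:
  fixes R1 :: "('a, 'm) ring_scheme" and R2 :: "('b, 'n) ring_scheme" and k :: nat
  assumes "cring R1" and "finite (carrier R1)"
    and "cring R2" and "finite (carrier R2)"
    and "k \<ge> 2"
  shows "ideal_zero_prod_prob k (RDirProd R1 R2) =
         ideal_zero_prod_prob k R1 * ideal_zero_prod_prob k R2"
proof -
  have "card {I. ideal I (RDirProd R1 R2)} = card {I. ideal I R1} * card {I. ideal I R2}"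
    using bij_betw_same_card[OF bij_betw_ideals_times[OF assms(1,3)[THEN cring.axioms(1)]]]
    by (simp add: card_cartesian_product)
  then show ?thesis
    \<comment> \<open>With index set \<open>{..<k}\<close> the numerators multiply, and the
      denominators do so because a power of a product is the product of the powers.\<close>
    using card_zero_prod_families_times[OF assms(1,3) finite_lessThan[of k]]
    by (simp add: ideal_zero_prod_prob_def power_mult_distrib)
qed

end
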